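(* Let $A$ be a ring with a unit $e$ and let $J$ be a (two-sided) ideal of $A$. An element $a\in A$ is a B-Fredholm element of $A$ modulo $J$ if and only if there exist an integer $n\geq 1$ and an element $c\in A$ such that $a^n c a^n-a^n\in J$ and $e-a^n c-c a^n$ is a Fredholm element in $A$ modulo $J$.
   Context: Let $A$ be a (not necessarily commutative) ring with unit $e$, $J$ a two-sided ideal of $A$, and $\pi:A\to A/J$ the canonical projection. An element $x$ of a unital ring $R$ is Drazin invertible in $R$ if there exist $y\in R$ and $k\in\mathbb{N}$ such that $yxy=y$, $xy=yx$ and $x^k y x=x^k$. An element $a\in A$ is a Fredholm element of $A$ modulo $J$ if $\pi(a)$ is invertible in $A/J$. An element $a\in A$ is a B-Fredholm element of $A$ modulo $J$ if $\pi(a)$ is Drazin invertible in $A/J$. *)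

theory Defs
  imports "HOL-Algebra.QuotRing"
begin

text \<open>
  The canonical projection from \<open>A\<close> onto \<open>A Quot J\<close> maps \<open>a\<close> to the coset \<open>J +>\<^bsub>A\<^esub> a\<close>.
  Rings are those of HOL-Algebra: unital, not necessarily commutative, possibly trivial;
  \<open>ideal\<close> means two-sided ideal, with \<open>J = carrier A\<close> allowed.
\<close>

text \<open>
  The exponent \<open>k\<close> may be \<open>0\<close>. This is harmless: for \<open>k = 0\<close> the conditions make \<open>x\<close>
  invertible, and then they also hold for every larger \<open>k\<close>.
\<close>

definition drazin_invertible :: "('a, 'b) ring_scheme \<Rightarrow> 'a \<Rightarrow> bool" where
  "drazin_invertible R x \<longleftrightarrow>
     x \<in> carrier R \<and>
     (\<exists>y\<in>carrier R. \<exists>k::nat.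
        y \<otimes>\<^bsub>R\<^esub> x \<otimes>\<^bsub>R\<^esub> y = y \<and>
        x \<otimes>\<^bsub>R\<^esub> y = y \<otimes>\<^bsub>R\<^esub> x \<and>
        x [^]\<^bsub>R\<^esub> k \<otimes>\<^bsub>R\<^esub> y \<otimes>\<^bsub>R\<^esub> x = x [^]\<^bsub>R\<^esub> k)"

definition fredholm_modulo :: "('a, 'b) ring_scheme \<Rightarrow> 'a set \<Rightarrow> 'a \<Rightarrow> bool" where
  "fredholm_modulo A J a \<longleftrightarrow> a \<in> carrier A \<and> J +>\<^bsub>A\<^esub> a \<in> Units (A Quot J)"

definition b_fredholm_modulo :: "('a, 'b) ring_scheme \<Rightarrow> 'a set \<Rightarrow> 'a \<Rightarrow> bool" where
  "b_fredholm_modulo A J a \<longleftrightarrow> a \<in> carrier A \<and> drazin_invertible (A Quot J) (J +>\<^bsub>A\<^esub> a)"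

end

theory Submission
  imports Defs
begin

text \<open>
  Everything takes place in \<open>R = A/J\<close>. If \<open>x\<close> has Drazin inverse \<open>y\<close> with exponent \<open>k\<close>, then
  for \<open>n = k + 1\<close> and \<open>c = y\<^sup>n\<close> the products \<open>x\<^sup>n c\<close> and \<open>c x\<^sup>n\<close> both equal the idempotent
  \<open>p = x y\<close>, and \<open>1 - 2 p\<close> is its own inverse. Conversely, let \<open>b = x\<^sup>n\<close>, \<open>b c b = b\<close> and let
  \<open>u = 1 - b c - c b\<close> be invertible. Then \<open>b u = - b\<^sup>2 c\<close> and \<open>u b = - c b\<^sup>2\<close>, so \<open>b\<close> lies in
  \<open>b\<^sup>2 R\<close> and in \<open>R b\<^sup>2\<close>, which yields a group inverse \<open>g\<close> of \<open>b\<close>. It commutes with \<open>x\<close>,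
  and \<open>x\<^bsup>n-1\<^esup> g\<close> is a Drazin inverse of \<open>x\<close>.
\<close>

text \<open>The one-sided factors give the same element \<open>b s = t b\<close>. It is an
  idempotent acting as a two-sided identity on \<open>b\<close>, and \<open>p s\<close> inverts
  \<open>b\<close> relative to it.\<close>

lemma (in monoid) group_inverse_exists:
  assumes [simp]: "b \<in> carrier G" "s \<in> carrier G" "t \<in> carrier G"
    and s: "b \<otimes> b \<otimes> s = b" and t: "t \<otimes> b \<otimes> b = b"
  shows "\<exists>g\<in>carrier G. b \<otimes> g = g \<otimes> b \<and> g \<otimes> b \<otimes> g = g \<and> b \<otimes> g \<otimes> b = b"
proof -
  define p where "p = b \<otimes> s"
  have [simp]: "p \<in> carrier G" by (simp add: p_def)
  \<comment> \<open>Evaluating \<open>t b b s\<close> in two ways gives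
    \<open>t b = b s\<close>.\<close>
  have "t \<otimes> b = t \<otimes> (b \<otimes> b \<otimes> s)" by (simp add: s)
  also have "\<dots> = t \<otimes> b \<otimes> b \<otimes> s" by (simp add: m_assoc)
  finally have tb: "t \<otimes> b = p" by (simp add: t p_def)
  have bp: "b \<otimes> p = b" using s by (simp add: p_def m_assoc)
  have pb: "p \<otimes> b = b" using t by (simp add: tb[symmetric])
  have pp: "p \<otimes> p = p" using pb by (simp add: p_def m_assoc[symmetric])
  define g where "g = p \<otimes> s"
  have [simp]: "g \<in> carrier G" by (simp add: g_def)
  have "t \<otimes> b \<otimes> s = t \<otimes> p" by (simp add: p_def m_assoc)
  then have g_alt: "g = t \<otimes> p" by (simp add: g_def tb)
  have bg: "b \<otimes> g = p" using bp by (simp add: g_def m_assoc[symmetric] p_def)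
  have gb: "g \<otimes> b = p" by (simp add: g_alt m_assoc pb tb)
  have "p \<otimes> g = g" by (simp add: g_def m_assoc[symmetric] pp)
  then show ?thesis by (intro bexI[of _ g]) (simp_all add: bg gb pb)
qed

text \<open>First \<open>x\<close> is shown to commute with the idempotent \<open>p = b g\<close>,
  since both \<open>x p\<close> and \<open>p x\<close> equal \<open>p x p\<close>; then
  \<open>g = g p = p g\<close> carries this over to \<open>g\<close>.\<close>

lemma (in monoid) group_inverse_commutes:
  assumes [simp]: "b \<in> carrier G" "g \<in> carrier G" "x \<in> carrier G"
    and bg: "b \<otimes> g = g \<otimes> b" and gbg: "g \<otimes> b \<otimes> g = g" and bgb: "b \<otimes> g \<otimes> b = b"
    and xb: "x \<otimes> b = b \<otimes> x"
  shows "x \<otimes> g = g \<otimes> x"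
proof -
  define p where "p = b \<otimes> g"
  have [simp]: "p \<in> carrier G" by (simp add: p_def)
  have p_alt: "p = g \<otimes> b" by (simp add: p_def bg)
  have pb: "p \<otimes> b = b" by (simp add: p_def bgb)
  have bp: "b \<otimes> p = b" using bgb by (simp add: p_alt m_assoc)
  have pg: "p \<otimes> g = g" by (simp add: p_alt gbg)
  have gp: "g \<otimes> p = g" using gbg by (simp add: p_def m_assoc)
  have "x \<otimes> p = x \<otimes> b \<otimes> g" by (simp add: p_def m_assoc)
  also have "\<dots> = p \<otimes> b \<otimes> x \<otimes> g" by (simp add: xb pb)
  also have "\<dots> = p \<otimes> (x \<otimes> b) \<otimes> g" by (simp add: xb m_assoc)
  also have "\<dots> = p \<otimes> x \<otimes> p" by (simp add: p_def m_assoc)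
  finally have xp: "x \<otimes> p = p \<otimes> x \<otimes> p" .
  have "p \<otimes> x = g \<otimes> (x \<otimes> b)" by (simp add: p_alt xb m_assoc)
  also have "\<dots> = g \<otimes> (x \<otimes> b) \<otimes> p" by (simp add: m_assoc bp)
  also have "\<dots> = p \<otimes> x \<otimes> p" by (simp add: xb p_alt m_assoc)
  finally have px: "p \<otimes> x = x \<otimes> p" using xp by simp
  \<comment> \<open>Inserting \<open>p\<close> and moving it past \<open>x\<close> supplies a factor
    \<open>b\<close>, which passes through \<open>x\<close> and is absorbed by the \<open>g\<close>
    on the left.\<close>
  have "g \<otimes> x = g \<otimes> (p \<otimes> x)" by (simp add: m_assoc[symmetric] gp)
  also have "\<dots> = g \<otimes> (x \<otimes> b) \<otimes> g" unfolding px by (simp add: p_def m_assoc)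
  also have "\<dots> = p \<otimes> x \<otimes> g" by (simp add: xb p_alt m_assoc)
  also have "\<dots> = x \<otimes> g" by (simp add: px m_assoc pg)
  finally show ?thesis by simp
qed

text \<open>Each induction step wraps the product in one more \<open>x\<close> and \<open>y\<close>,
  and idempotence collapses it again. The exponent is positive because exponent 0 would give the
  unit instead of \<open>x y\<close>.\<close>

lemma (in monoid) power_mult_inverse_power:
  assumes [simp]: "x \<in> carrier G" "y \<in> carrier G"
    and xy: "x \<otimes> y = y \<otimes> x" and idem: "x \<otimes> y \<otimes> (x \<otimes> y) = x \<otimes> y"
  shows "x [^] Suc n \<otimes> y [^] Suc n = x \<otimes> y"
proof (induction n)
  case (Suc n)
  have "x [^] Suc (Suc n) \<otimes> y [^] Suc (Suc n) = x \<otimes> (x [^] Suc n \<otimes> y [^] Suc n) \<otimes> y"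
    unfolding nat_pow_Suc2[OF assms(1), of "Suc n"] nat_pow_Suc[of y "Suc n"]
    by (simp add: m_assoc del: nat_pow_Suc)
  also have "\<dots> = x \<otimes> (y \<otimes> x) \<otimes> y" by (simp only: Suc xy)
  also have "\<dots> = x \<otimes> y \<otimes> (x \<otimes> y)" by (simp add: m_assoc)
  finally show ?case by (simp add: idem del: nat_pow_Suc)
qed simp

text \<open>The element \<open>q = 1 - 2 p\<close> satisfies \<open>q p = - p\<close>, hence
  \<open>q q = q + 2 p = 1\<close>.\<close>

lemma (in ring) one_minus_twice_idempotent_Unit:
  assumes [simp]: "p \<in> carrier R" and pp: "p \<otimes> p = p"
  shows "\<one> \<ominus> p \<ominus> p \<in> Units R"
proof -
  have "(\<one> \<ominus> p \<ominus> p) \<otimes> p = \<ominus> p"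
    by (simp add: minus_eq l_distr l_minus pp r_neg)
  then have "(\<one> \<ominus> p \<ominus> p) \<otimes> (\<one> \<ominus> p \<ominus> p) = (\<one> \<ominus> p \<ominus> p) \<oplus> p \<oplus> p"
    by (simp add: minus_eq r_distr r_minus)
  also have "\<dots> = \<one>" by (simp add: minus_eq a_assoc l_neg)
  finally show ?thesis by (auto simp: Units_def)
qed

text \<open>Stated for an arbitrary ring so that it can be applied to
  \<open>A Quot J\<close>.\<close>

lemma (in ring) drazin_invertible_iff_power:
  assumes [simp]: "x \<in> carrier R"
  shows "drazin_invertible R x \<longleftrightarrow>
    (\<exists>n\<ge>1::nat. \<exists>c\<in>carrier R.
       x [^] n \<otimes> c \<otimes> x [^] n = x [^] n \<and>
       \<one> \<ominus> x [^] n \<otimes> c \<ominus> c \<otimes> x [^] n \<in> Units R)"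
proof
  assume "drazin_invertible R x"
  then obtain y and k :: nat where [simp]: "y \<in> carrier R"
    and yxy: "y \<otimes> x \<otimes> y = y" and xy: "x \<otimes> y = y \<otimes> x"
    and xk: "x [^] k \<otimes> y \<otimes> x = x [^] k"
    unfolding drazin_invertible_def by blast
  \<comment> \<open>The successor ensures a positive exponent even when
    \<open>k = 0\<close>.\<close>
  define n where "n = Suc k"
  define c where "c = y [^] n"
  define p where "p = x \<otimes> y"
  have [simp]: "c \<in> carrier R" "p \<in> carrier R" by (simp_all add: c_def p_def)
  have pp: "p \<otimes> p = p"
    unfolding p_def by (metis yxy m_assoc \<open>y \<in> carrier R\<close> assms m_closed)
  have xc: "x [^] n \<otimes> c = p"
    unfolding n_def c_def p_def by (rule power_mult_inverse_power) (use pp in \<open>simp_all add: xy p_def\<close>)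
  have cx: "c \<otimes> x [^] n = p"
    unfolding n_def c_def p_def xy
    by (rule power_mult_inverse_power) (use pp in \<open>simp_all add: xy p_def\<close>)
  have "x [^] n \<otimes> p = x \<otimes> (x [^] k \<otimes> y \<otimes> x)"
    unfolding n_def nat_pow_Suc2[OF assms] by (simp add: p_def xy m_assoc)
  then have "x [^] n \<otimes> p = x [^] n" by (simp add: xk n_def nat_pow_Suc2[symmetric] del: nat_pow_Suc)
  then have "x [^] n \<otimes> c \<otimes> x [^] n = x [^] n" by (simp add: m_assoc cx)
  moreover have "\<one> \<ominus> x [^] n \<otimes> c \<ominus> c \<otimes> x [^] n \<in> Units R"
    by (simp add: xc cx one_minus_twice_idempotent_Unit pp)
  moreover have "n \<ge> 1" by (simp add: n_def)
  ultimately show "\<exists>n\<ge>1::nat. \<exists>c\<in>carrier R. x [^] n \<otimes> c \<otimes> x [^] n = x [^] n \<and>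
      \<one> \<ominus> x [^] n \<otimes> c \<ominus> c \<otimes> x [^] n \<in> Units R"
    using \<open>c \<in> carrier R\<close> by blast
next
  assume "\<exists>n\<ge>1::nat. \<exists>c\<in>carrier R. x [^] n \<otimes> c \<otimes> x [^] n = x [^] n \<and>
      \<one> \<ominus> x [^] n \<otimes> c \<ominus> c \<otimes> x [^] n \<in> Units R"
  then obtain n :: nat and c where "n \<ge> 1" and [simp]: "c \<in> carrier R"
    and bcb': "x [^] n \<otimes> c \<otimes> x [^] n = x [^] n"
    and u': "\<one> \<ominus> x [^] n \<otimes> c \<ominus> c \<otimes> x [^] n \<in> Units R" by blast
  define b where "b = x [^] n"
  define u where "u = \<one> \<ominus> b \<otimes> c \<ominus> c \<otimes> b"
  have [simp]: "b \<in> carrier R" by (simp add: b_def)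
  have bcb: "b \<otimes> c \<otimes> b = b" and u: "u \<in> Units R" using bcb' u' by (simp_all add: b_def u_def)
  have [simp]: "u \<in> carrier R" "inv u \<in> carrier R" using u by (simp_all add: Units_closed)
  have bcb2: "b \<otimes> (c \<otimes> b) = b" using bcb by (simp add: m_assoc)
  \<comment> \<open>By \<open>b c b = b\<close>, one of the two products in \<open>u\<close> cancels
    the unit term after multiplication by \<open>b\<close> on either side.\<close>
  have "b \<otimes> u = b \<ominus> b \<otimes> (b \<otimes> c) \<ominus> b"
    by (simp add: u_def minus_eq r_distr r_minus bcb2)
  then have bu: "b \<otimes> u = \<ominus> (b \<otimes> b \<otimes> c)"
    by (simp add: minus_eq m_assoc a_comm[of b] a_assoc l_neg)
  have "u \<otimes> b = b \<ominus> b \<ominus> c \<otimes> b \<otimes> b"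
    by (simp add: u_def minus_eq l_distr l_minus bcb)
  then have ub: "u \<otimes> b = \<ominus> (c \<otimes> b \<otimes> b)"
    by (simp add: minus_eq r_neg)
  \<comment> \<open>Cancelling \<open>u\<close> yields the factors \<open>s = - c u^-1\<close> and
    \<open>t = - u^-1 c\<close>.\<close>
  have "b \<otimes> b \<otimes> (\<ominus> (c \<otimes> inv u)) = b \<otimes> u \<otimes> inv u"
    unfolding bu by (simp add: m_assoc l_minus r_minus)
  then have s: "b \<otimes> b \<otimes> (\<ominus> (c \<otimes> inv u)) = b"
    using u by (simp add: m_assoc)
  have "\<ominus> (inv u \<otimes> c) \<otimes> b \<otimes> b = inv u \<otimes> (u \<otimes> b)"
    unfolding ub by (simp add: m_assoc l_minus r_minus)
  then have t: "\<ominus> (inv u \<otimes> c) \<otimes> b \<otimes> b = b"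
    using u by (simp add: m_assoc[symmetric])
  obtain g where [simp]: "g \<in> carrier R" and bg: "b \<otimes> g = g \<otimes> b"
    and gbg: "g \<otimes> b \<otimes> g = g" and bgb: "b \<otimes> g \<otimes> b = b"
    using group_inverse_exists[OF _ _ _ s t] by auto
  obtain m where n: "n = Suc m" using \<open>n \<ge> 1\<close> by (cases n) auto
  have b1: "b = x [^] m \<otimes> x" and b2: "b = x \<otimes> x [^] m"
    unfolding b_def n by (simp, rule nat_pow_Suc2, simp)
  have xb: "x \<otimes> b = b \<otimes> x"
    by (subst b1, subst b2) (simp add: m_assoc)
  have xg: "x \<otimes> g = g \<otimes> x"
    by (rule group_inverse_commutes[of b]) (use bg gbg bgb xb in simp_all)
  \<comment> \<open>With \<open>n = m + 1\<close>, multiplying \<open>y\<close> by \<open>x\<close>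
    on either side completes \<open>x^m\<close> to \<open>b\<close>, so both products equal the
    idempotent \<open>b g\<close>.\<close>
  define y where "y = x [^] m \<otimes> g"
  have [simp]: "y \<in> carrier R" by (simp add: y_def)
  have xy: "x \<otimes> y = b \<otimes> g" by (simp add: y_def b2 m_assoc)
  have yx: "y \<otimes> x = b \<otimes> g" by (simp add: y_def b1 m_assoc xg)
  have "y \<otimes> x \<otimes> y = y \<otimes> (x \<otimes> y)" by (simp add: m_assoc)
  also have "\<dots> = x [^] m \<otimes> (g \<otimes> b \<otimes> g)" by (simp add: y_def xy[unfolded y_def] m_assoc)
  finally have "y \<otimes> x \<otimes> y = y" by (simp add: gbg y_def)
  moreover have "x [^] n \<otimes> y \<otimes> x = x [^] n"
    unfolding b_def[symmetric] using bgb by (simp add: m_assoc yx) (simp add: bg m_assoc)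
  ultimately show "drazin_invertible R x"
    unfolding drazin_invertible_def using xy yx by (intro conjI bexI[of _ y] exI[of _ n]) auto
qed

theorem theorem2p6:
  fixes A (structure) and J :: "'a set" and a :: 'a
  assumes "ring A" and "ideal J A" and "a \<in> carrier A"
  shows "b_fredholm_modulo A J a \<longleftrightarrow>
    (\<exists>n\<ge>1::nat. \<exists>c\<in>carrier A.
       a [^] n \<otimes> c \<otimes> a [^] n \<ominus> a [^] n \<in> J \<and>
       fredholm_modulo A J (\<one> \<ominus> a [^] n \<otimes> c \<ominus> c \<otimes> a [^] n))"
proof -
  interpret ring A by fact
  interpret J: ideal J A by fact
  interpret Q: ring "A Quot J" by (rule J.quotient_is_ring)
  interpret h: ring_hom_ring A "A Quot J" "(+>) J" by (rule J.rcos_ring_hom_ring)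
  note [simp] = \<open>a \<in> carrier A\<close>
  let ?x = "J +> a"
  have pow: "J +> a [^] n = ?x [^]\<^bsub>A Quot J\<^esub> n" for n :: nat
    by (simp add: h.hom_nat_pow)
  \<comment> \<open>Surjectivity of the projection lets a witness in the quotient be lifted to some
    \<open>c\<close> in \<open>A\<close>.\<close>
  have onto: "carrier (A Quot J) = (+>) J ` carrier A"
    unfolding FactRing_def A_RCOSETS_def' by auto
  \<comment> \<open>A difference lies in \<open>J\<close> exactly when the two cosets agree, and the
    projection preserves products and powers.\<close>
  have eq: "a [^] n \<otimes> c \<otimes> a [^] n \<ominus> a [^] n \<in> J \<longleftrightarrow>
      ?x [^]\<^bsub>A Quot J\<^esub> n \<otimes>\<^bsub>A Quot J\<^esub> (J +> c) \<otimes>\<^bsub>A Quot J\<^esub> ?x [^]\<^bsub>A Quot J\<^esub> n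
        = ?x [^]\<^bsub>A Quot J\<^esub> n"
    if "c \<in> carrier A" for n :: nat and c
    using that by (simp add: quotient_eq_iff_same_a_r_cos[OF J.ideal_axioms] pow)
  have unit: "fredholm_modulo A J (\<one> \<ominus> a [^] n \<otimes> c \<ominus> c \<otimes> a [^] n) \<longleftrightarrow>
      \<one>\<^bsub>A Quot J\<^esub> \<ominus>\<^bsub>A Quot J\<^esub> ?x [^]\<^bsub>A Quot J\<^esub> n \<otimes>\<^bsub>A Quot J\<^esub> (J +> c)
        \<ominus>\<^bsub>A Quot J\<^esub> (J +> c) \<otimes>\<^bsub>A Quot J\<^esub> ?x [^]\<^bsub>A Quot J\<^esub> n \<in> Units (A Quot J)"
    if "c \<in> carrier A" for n :: nat and c
    using that by (simp add: fredholm_modulo_def minus_eq Q.minus_eq pow)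
  have "b_fredholm_modulo A J a \<longleftrightarrow> drazin_invertible (A Quot J) ?x"
    by (simp add: b_fredholm_modulo_def)
  also have "\<dots> \<longleftrightarrow> (\<exists>n\<ge>1::nat. \<exists>c\<in>carrier A.
       a [^] n \<otimes> c \<otimes> a [^] n \<ominus> a [^] n \<in> J \<and>
       fredholm_modulo A J (\<one> \<ominus> a [^] n \<otimes> c \<ominus> c \<otimes> a [^] n))"
    by (subst Q.drazin_invertible_iff_power) (simp_all add: onto eq unit)
  finally show ?thesis .
qed

end
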